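(* For $q>2$ (where $q$ is a prime power), the degree sequence of the solvable graph $\Gamma_{\mathfrak{S}}(\mathfrak{gl}_2(\mathbb{F}_q))$ consists of the value $2q^3-q^2-q-1$ occurring $\frac{q^2(q^2-1)}{2}$ times, the value $q^3-q-1$ occurring $q^3-q$ times, and the value $q^2-q-1$ occurring $\frac{q^2(q-1)^2}{2}$ times.
   Context: $\mathbb{F}_q$ is the field with $q$ elements, and $\mathfrak{gl}_2(\mathbb{F}_q)$ is the Lie algebra of all $2\times 2$ matrices over $\mathbb{F}_q$ with bracket $[x,y]=xy-yx$. For elements $x,y$ of a Lie algebra $L$, $\langle x,y\rangle$ denotes the Lie subalgebra generated by $x$ and $y$. The solvabilizer of $L$ is $\mathrm{sol}(L)=\{x\in L \mid \langle h,x\rangle \text{ is solvable for all } h\in L\}$. For a finite-dimensional non-solvable Lie algebra $L$, the solvable graph $\Gamma_{\mathfrak{S}}(L)$ is the simple undirected graph with vertex set $L\setminus \mathrm{sol}(L)$ in which two distinct vertices $x,y$ are adjacent if and only if $\langle x,y\rangle$ is a solvable subalgebra of $L$; the same notation is also used for solvable $L$, where the graph is empty. The degree sequence is the list of vertex degrees with multiplicity.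
   Formalization: The formal theorem also assumes that gl_2(F_q) is non-solvable, i.e. that q is odd; for q = 4, 8, ... the algebra is solvable, so its solvable graph is empty and the claimed degree sequence, with q^4 - q > 0 entries, is false. *)

theory Defs
  imports "HOL-Analysis.Analysis" "HOL-Library.Multiset"
begin

text \<open>
  A Lie algebra over a field: the underlying vector space is the whole type \<open>'v\<close>.
\<close>

locale lie_algebra = vector_space scale
  for scale :: "'k::field \<Rightarrow> 'v::ab_group_add \<Rightarrow> 'v" +
  fixes bracket :: "'v \<Rightarrow> 'v \<Rightarrow> 'v"
  assumes bracket_add_left: "bracket (x + y) z = bracket x z + bracket y z"
    and bracket_add_right: "bracket x (y + z) = bracket x y + bracket x z"
    and bracket_scale_left: "bracket (scale c x) y = scale c (bracket x y)"
    and bracket_scale_right: "bracket x (scale c y) = scale c (bracket x y)"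
    and bracket_self: "bracket x x = 0"
    and jacobi: "bracket x (bracket y z) + bracket y (bracket z x) + bracket z (bracket x y) = 0"
begin

definition lie_subalgebra :: "'v set \<Rightarrow> bool" where
  "lie_subalgebra S \<longleftrightarrow> subspace S \<and> (\<forall>x\<in>S. \<forall>y\<in>S. bracket x y \<in> S)"

definition generated :: "'v set \<Rightarrow> 'v set" where
  "generated X = \<Inter>{S. lie_subalgebra S \<and> X \<subseteq> S}"

definition derived :: "'v set \<Rightarrow> 'v set" where
  "derived S = span {bracket x y | x y. x \<in> S \<and> y \<in> S}"

definition solvable :: "'v set \<Rightarrow> bool" where
  "solvable S \<longleftrightarrow> (\<exists>n. (derived ^^ n) S = {0})"

definition solvabilizer :: "'v set" where
  "solvabilizer = {x. \<forall>h. solvable (generated {h, x})}"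

end

text \<open>A graph is a pair of its vertex set and its set of edges, each edge being a two-element set.\<close>

type_synonym 'v graph = "'v set \<times> 'v set set"

definition degree :: "'v graph \<Rightarrow> 'v \<Rightarrow> nat" where
  "degree G v = card {e \<in> snd G. v \<in> e}"

text \<open>Meaningful for finite graphs only: \<^const>\<open>mset_set\<close> of an infinite set is empty.\<close>

definition degree_sequence :: "'v graph \<Rightarrow> nat multiset" where
  "degree_sequence G = image_mset (degree G) (mset_set (fst G))"

definition (in lie_algebra) solvable_graph :: "'v graph" where
  "solvable_graph =
     (UNIV - solvabilizer,
      {{x, y} | x y. x \<in> UNIV - solvabilizer \<and> y \<in> UNIV - solvabilizer \<and> x \<noteq> y \<and>
                     solvable (generated {x, y})})"

text \<open>
  On \<open>'a^2^2\<close> the operation \<open>*\<close> is the componentwise product;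
  the matrix product is \<open>**\<close>.
\<close>

definition mat_scale :: "'a::field \<Rightarrow> 'a^2^2 \<Rightarrow> 'a^2^2" where
  "mat_scale c x = (\<chi> i j. c * x $ i $ j)"

definition commutator :: "'a::field^2^2 \<Rightarrow> 'a^2^2 \<Rightarrow> 'a^2^2" where
  "commutator x y = x ** y - y ** x"

lemma commutator_nth:
  "commutator x y $ i $ j =
     x$i$1 * y$1$j + x$i$2 * y$2$j - (y$i$1 * x$1$j + y$i$2 * x$2$j)"
  by (simp add: commutator_def matrix_matrix_mult_def sum_2)

interpretation gl2: lie_algebra mat_scale commutator
  by unfold_locales
    (simp_all add: vec_eq_iff forall_2 mat_scale_def commutator_nth algebra_simps)

lemma gl2_nonsolvable_if:
  assumes "(2::'a::field) \<noteq> 0"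
  shows "\<not> gl2.solvable (UNIV :: ('a^2^2) set)"
proof -
  define h e f :: "'a^2^2" where
    "h = (\<chi> i j. if i = j then if i = 1 then 1 else - 1 else 0)" and
    "e = (\<chi> i j. if i = 1 \<and> j = 2 then 1 else 0)" and
    "f = (\<chi> i j. if i = 2 \<and> j = 1 then 1 else 0)"
  note defs = h_def e_def f_def
  have h: "h = mat_scale 1 (commutator e f)"
    by (simp add: vec_eq_iff forall_2 mat_scale_def commutator_nth defs)
  have e: "e = mat_scale (1/2) (commutator h e)"
    using assms by (simp add: vec_eq_iff forall_2 mat_scale_def commutator_nth defs)
  have f: "f = mat_scale (1/2) (commutator f h)"
    using assms by (simp add: vec_eq_iff forall_2 mat_scale_def commutator_nth defs)
  have *: "h \<in> gl2.derived S \<and> e \<in> gl2.derived S \<and> f \<in> gl2.derived S"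
    if S: "h \<in> S \<and> e \<in> S \<and> f \<in> S" for S
  proof -
    have br: "mat_scale c (commutator x y) \<in> gl2.derived S" if "x \<in> S" "y \<in> S" for c x y
      unfolding gl2.derived_def using that by (intro gl2.span_scale gl2.span_base) blast
    show ?thesis using br[of e f 1] br[of h e "1/2"] br[of f h "1/2"] S
      unfolding h[symmetric] e[symmetric] f[symmetric] by blast
  qed
  have "h \<in> (gl2.derived ^^ n) UNIV \<and> e \<in> (gl2.derived ^^ n) UNIV \<and> f \<in> (gl2.derived ^^ n) UNIV" for n
  proof (induction n)
    case (Suc n)
    then show ?case using *[OF Suc] by simp
  qed simp
  moreover have "e \<noteq> 0" by (auto simp: vec_eq_iff e_def)
  ultimately show ?thesis unfolding gl2.solvable_def by blast
qed

lemma gl2_solvable_if: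
  assumes "(2::'a::field) = 0"
  shows "gl2.solvable (UNIV :: ('a^2^2) set)"
proof -
  have add_self: "x + x = 0" for x :: 'a
    using assms by (metis mult_2 mult_zero_left)
  let ?A = "{x::'a^2^2. x$1$1 + x$2$2 = 0}"
  let ?B = "{x::'a^2^2. x$1$1 = x$2$2 \<and> x$1$2 = 0 \<and> x$2$1 = 0}"
  have neg: "- x = x" for x :: 'a using add_self[of x] by (simp add: minus_unique)
  have 1: "gl2.derived UNIV \<subseteq> ?A"
    unfolding gl2.derived_def
    by (rule gl2.span_minimal)
      (auto simp: gl2.subspace_def commutator_nth mat_scale_def algebra_simps
        simp flip: distrib_left)
  have 2: "gl2.derived S \<subseteq> ?B" if "S \<subseteq> ?A" for S
    unfolding gl2.derived_def
  proof (rule gl2.span_minimal)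
    have "commutator x y \<in> ?B" if "x \<in> ?A" "y \<in> ?A" for x y
    proof -
      have d: "x$2$2 = x$1$1" "y$2$2 = y$1$1"
        using that neg by (metis (mono_tags, lifting) add_eq_0_iff mem_Collect_eq)+
      have "s - t = t - s" for s t :: 'a
        using neg[of "s - t"] by (simp only: minus_diff_eq)
      then have "x$1$2 * y$2$1 - x$2$1 * y$1$2 = x$2$1 * y$1$2 - x$1$2 * y$2$1" .
      then show ?thesis
        by (simp add: commutator_nth d mult.commute)
    qed
    with that show "{commutator x y |x y. x \<in> S \<and> y \<in> S} \<subseteq> ?B" by blast
    show "gl2.subspace ?B" by (auto simp: gl2.subspace_def mat_scale_def)
  qed
  have 3: "gl2.derived S \<subseteq> {0}" if "S \<subseteq> ?B" for S
    unfolding gl2.derived_def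
  proof (rule gl2.span_minimal)
    have "commutator x y = 0" if "x \<in> ?B" "y \<in> ?B" for x y
      using that by (auto simp: vec_eq_iff forall_2 commutator_nth algebra_simps)
    with that show "{commutator x y |x y. x \<in> S \<and> y \<in> S} \<subseteq> {0}" by blast
  qed (rule gl2.subspace_single_0)
  have "(gl2.derived ^^ 3) UNIV \<subseteq> ({0} :: ('a^2^2) set)"
    using 3[OF 2[OF 1]] by (simp add: numeral_3_eq_3)
  moreover have "0 \<in> gl2.derived S" for S :: "('a^2^2) set"
    unfolding gl2.derived_def by (rule gl2.span_zero)
  ultimately have "(gl2.derived ^^ 3) UNIV = ({0} :: ('a^2^2) set)"
    by (auto simp: numeral_3_eq_3)
  then show ?thesis unfolding gl2.solvable_def by blast
qed

text \<open>
  The solvable graph is attached to a non-solvable Lie algebra. For \<open>gl\<^sub>2\<close> this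
  condition excludes exactly the fields of characteristic 2, where \<open>sl\<^sub>2\<close> is
  nilpotent.
\<close>

corollary gl2_solvable_iff:
  "gl2.solvable (UNIV :: ('a::field^2^2) set) \<longleftrightarrow> (2::'a) = 0"
  using gl2_nonsolvable_if gl2_solvable_if by blast

end

theory Submission
  imports Defs
begin

text \<open>
  In odd characteristic, \<open>\<langle>x, y\<rangle>\<close> is solvable if and only if \<open>z = [x, y]\<close> is singular.
  If \<open>det z = 0\<close>, then \<open>x\<close> and \<open>y\<close> normalise the line of \<open>z\<close>, so \<open>span {x, y, z}\<close>
  is a solvable subalgebra; if \<open>det z \<noteq> 0\<close>, then \<open>z\<close>, \<open>[x, z]\<close>, \<open>[y, z]\<close> and their brackets
  with \<open>z\<close> survive in every derived subalgebra.

  For a fixed non-scalar \<open>x\<close> with characteristic discriminant \<open>\<Delta>\<close>, a linear change of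
  coordinates turns the equation \<open>det [x, y] = 0\<close> into \<open>m\<^sup>2 = \<Delta> u\<^sup>2\<close> with two further free
  coordinates. Hence the degree of \<open>x\<close> depends only on the number \<open>\<rho>(\<Delta>) \<in> {0, 1, 2}\<close> of square
  roots of \<open>\<Delta>\<close>, and it remains to count the matrices of given discriminant.
\<close>

section \<open>Solvability of two-generated subalgebras\<close>

context lie_algebra
begin

lemma derived_mono: "S \<subseteq> T \<Longrightarrow> derived S \<subseteq> derived T"
  unfolding derived_def by (intro span_mono) blast

lemma derived_pow_mono: "S \<subseteq> T \<Longrightarrow> (derived ^^ n) S \<subseteq> (derived ^^ n) T"
  by (induction n) (simp_all add: derived_mono)

lemma zero_in_derived: "0 \<in> derived S"
  unfolding derived_def by (rule span_zero)

lemma bracket_in_derived: "x \<in> S \<Longrightarrow> y \<in> S \<Longrightarrow> bracket x y \<in> derived S"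
  unfolding derived_def by (rule span_base) blast

lemma derived_scale_cancel:
  assumes "scale c x \<in> derived S" and "c \<noteq> 0"
  shows "x \<in> derived S"
  using span_scale[of "scale c x" _ "inverse c"] assms by (simp add: derived_def)

lemma lie_subalgebra_generated: "lie_subalgebra (generated X)"
  unfolding generated_def lie_subalgebra_def
  by (auto intro!: subspace_Inter simp: lie_subalgebra_def)

lemma generated_base: "X \<subseteq> generated X"
  unfolding generated_def by blast

lemma generated_minimal: "lie_subalgebra S \<Longrightarrow> X \<subseteq> S \<Longrightarrow> generated X \<subseteq> S"
  unfolding generated_def by blast

lemma bracket_anticomm: "bracket y x = - bracket x y"
proof -
  have "bracket (x + y) (x + y) = 0" by (rule bracket_self)
  then have "bracket x y + bracket y x = 0"
    unfolding bracket_add_left bracket_add_right by (simp add: bracket_self add.commute)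
  then show ?thesis by (metis minus_unique)
qed

text \<open>The span of \<open>x\<close>, \<open>y\<close> and \<open>z = [x, y]\<close> is already
  a subalgebra, and all its brackets are multiples of \<open>z\<close>, so its second derived
  algebra vanishes.\<close>

lemma solvable_generated_pair_if:
  assumes x: "bracket x (bracket x y) = scale c (bracket x y)"
    and y: "bracket y (bracket x y) = scale d (bracket x y)"
  shows "solvable (generated {x, y})"
proof -
  define z where "z = bracket x y"
  \<comment> \<open>Explicit coefficients let a bracket of two elements be expanded at once;
    \<open>x\<close>, \<open>y\<close>, \<open>z\<close> may be linearly dependent.\<close>
  define M where "M = {scale a x + scale b y + scale e z | a b e. True}"
  have M: "\<exists>k. bracket v w = scale k z" if "v \<in> M" "w \<in> M" for v w
  proof -
    from that obtain a b e a' b' e'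
      where v: "v = scale a x + scale b y + scale e z"
        and w: "w = scale a' x + scale b' y + scale e' z"
      unfolding M_def by blast
    have br: "bracket x z = scale c z" "bracket y z = scale d z"
      "bracket z x = scale (- c) z" "bracket z y = scale (- d) z"
      "bracket x y = z" "bracket y x = scale (- 1) z"
      using x y bracket_anticomm[of x z] bracket_anticomm[of y z] bracket_anticomm[of x y]
      by (simp_all add: z_def)
    have "bracket v w = scale (a * b' - b * a' + a * e' * c - e * a' * c
        + b * e' * d - e * b' * d) z"
      unfolding v w
      by (simp add: bracket_add_left bracket_add_right bracket_scale_left bracket_scale_right
          bracket_self br scale_left_distrib scale_left_diff_distrib algebra_simps)
    then show ?thesis ..
  qed
  have sub: "subspace M"
  proof (rule subspaceI)
    show "0 \<in> M"
      unfolding M_def by (rule CollectI, intro exI[of _ 0]) simp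
  next
    fix v w assume "v \<in> M" "w \<in> M"
    then obtain a b e a' b' e'
      where v: "v = scale a x + scale b y + scale e z"
        and w: "w = scale a' x + scale b' y + scale e' z"
      unfolding M_def by blast
    have "v + w = scale (a + a') x + scale (b + b') y + scale (e + e') z"
      unfolding v w by (simp add: scale_left_distrib)
    then show "v + w \<in> M" unfolding M_def by blast
  next
    fix k v assume "v \<in> M"
    then obtain a b e where v: "v = scale a x + scale b y + scale e z"
      unfolding M_def by blast
    have "scale k v = scale (k * a) x + scale (k * b) y + scale (k * e) z"
      unfolding v by (simp add: scale_right_distrib)
    then show "scale k v \<in> M" unfolding M_def by blast
  qed
  have "scale k z \<in> M" for k
    unfolding M_def by (rule CollectI, rule exI[of _ 0], rule exI[of _ 0]) auto
  with M sub have "lie_subalgebra M"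
    unfolding lie_subalgebra_def by metis
  moreover have "x \<in> M" "y \<in> M"
    unfolding M_def
    by (rule CollectI, rule exI[of _ 1], rule exI[of _ 0], rule exI[of _ 0], simp)
       (rule CollectI, rule exI[of _ 0], rule exI[of _ 1], rule exI[of _ 0], simp)
  ultimately have gen: "generated {x, y} \<subseteq> M"
    by (intro generated_minimal) auto
  have 1: "derived M \<subseteq> span {z}"
    unfolding derived_def
  proof (rule span_minimal)
    show "{bracket v w |v w. v \<in> M \<and> w \<in> M} \<subseteq> span {z}"
      unfolding span_singleton using M by blast
  qed (rule subspace_span)
  have 2: "derived (span {z}) \<subseteq> {0}"
    unfolding derived_def
  proof (rule span_minimal)
    show "{bracket v w |v w. v \<in> span {z} \<and> w \<in> span {z}} \<subseteq> {0}"
      by (auto simp: span_singleton bracket_scale_left bracket_scale_right bracket_self)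
  qed (rule subspace_single_0)
  have "(derived ^^ 2) (generated {x, y}) \<subseteq> (derived ^^ 2) M"
    by (rule derived_pow_mono) (rule gen)
  also have "\<dots> \<subseteq> {0}"
    using derived_mono[OF 1] 2 by (simp add: numeral_2_eq_2)
  finally have "(derived ^^ 2) (generated {x, y}) = {0}"
    using zero_in_derived by (auto simp: numeral_2_eq_2)
  then show ?thesis unfolding solvable_def by blast
qed

text \<open>Five vectors reproduce themselves under \<open>derived\<close>: \<open>z\<close> comes
  from \<open>[u, v]\<close>, \<open>u\<close> and \<open>v\<close> come back from the double
  brackets with \<open>z\<close>, and \<open>[z, u]\<close>, \<open>[z, v]\<close> are brackets
  outright.\<close>

lemma not_solvable_generated_pair_if:
  fixes x y
  defines "z \<equiv> bracket x y"
  defines "u \<equiv> bracket x z" and "v \<equiv> bracket y z"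
  assumes uv: "bracket u v = scale l z"
    and u: "bracket z (bracket z u) = scale k u"
    and v: "bracket z (bracket z v) = scale k v"
    and l: "l \<noteq> 0" and k: "k \<noteq> 0" and z: "z \<noteq> 0"
  shows "\<not> solvable (generated {x, y})"
proof -
  have br: "bracket a b \<in> generated {x, y}"
    if "a \<in> generated {x, y}" "b \<in> generated {x, y}" for a b
    using lie_subalgebra_generated[of "{x, y}"] that unfolding lie_subalgebra_def by blast
  have "{z, u, v, bracket z u, bracket z v} \<subseteq> (derived ^^ n) (generated {x, y})" for n
  proof (induction n)
    case 0
    have "x \<in> generated {x, y}" "y \<in> generated {x, y}"
      using generated_base[of "{x, y}"] by auto
    then show ?case
      unfolding z_def u_def v_def by (simp add: br)
  next
    case (Suc n)
    let ?D = "(derived ^^ n) (generated {x, y})"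
    have m: "z \<in> ?D" "u \<in> ?D" "v \<in> ?D" "bracket z u \<in> ?D" "bracket z v \<in> ?D"
      using Suc by auto
    have "z \<in> derived ?D"
      using bracket_in_derived[OF m(2,3)] unfolding uv by (rule derived_scale_cancel) (rule l)
    moreover have "u \<in> derived ?D"
      using bracket_in_derived[OF m(1,4)] unfolding u by (rule derived_scale_cancel) (rule k)
    moreover have "v \<in> derived ?D"
      using bracket_in_derived[OF m(1,5)] unfolding v by (rule derived_scale_cancel) (rule k)
    ultimately show ?case using bracket_in_derived[OF m(1,2)] bracket_in_derived[OF m(1,3)] by simp
  qed
  with z show ?thesis unfolding solvable_def by blast
qed

end

section \<open>Commutators of two-by-two matrices\<close>

lemma mat_scale_nth [simp]: "mat_scale c x $ i $ j = c * x $ i $ j"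
  by (simp add: mat_scale_def)

text \<open>Scalar matrices are central, so the diagonals of \<open>x\<close> and \<open>y\<close>
  enter only through the difference of their entries.\<close>

lemma commutator_entries:
  fixes x y :: "'a::field^2^2"
  shows "commutator x y $ 1 $ 1 = x$1$2 * y$2$1 - x$2$1 * y$1$2"
    and "commutator x y $ 1 $ 2 = (x$1$1 - x$2$2) * y$1$2 - x$1$2 * (y$1$1 - y$2$2)"
    and "commutator x y $ 2 $ 1 = x$2$1 * (y$1$1 - y$2$2) - (x$1$1 - x$2$2) * y$2$1"
    and "commutator x y $ 2 $ 2 = - (x$1$2 * y$2$1 - x$2$1 * y$1$2)"
  by (simp_all add: commutator_nth algebra_simps)

text \<open>\<open>perp\<close> says that \<open>x z\<close> has trace 0. A nonzero nilpotent
  \<open>z\<close> is a column \<open>v\<close> times a row \<open>w\<close> with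
  \<open>w v = 0\<close>; then \<open>w x v = 0\<close> makes \<open>x v\<close> a multiple of
  \<open>v\<close> and \<open>w x\<close> a multiple of \<open>w\<close>, so \<open>[x, z]\<close>
  is a multiple of \<open>z\<close>.\<close>

lemma commutator_singular_traceless:
  fixes x z :: "'a::field^2^2"
  assumes tr: "z$2$2 = - z$1$1" and det: "det z = 0"
    and perp: "(x$1$1 - x$2$2) * z$1$1 + x$1$2 * z$2$1 + x$2$1 * z$1$2 = 0"
  shows "\<exists>c. commutator x z = mat_scale c z"
proof -
  have det': "z$1$1 * z$1$1 + z$1$2 * z$2$1 = 0"
    using det tr unfolding det_2 by algebra
  show ?thesis
  proof (cases "z$1$2 = 0")
    case False
    \<comment> \<open>The (1,2) entry of \<open>[x, z]\<close> forces this factor; the other entries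
      are compared after multiplication by \<open>z$1$2\<close>.\<close>
    define k where "k = (x$1$1 - x$2$2) - 2 * x$1$2 * z$1$1 / z$1$2"
    have k: "k * z$1$2 = (x$1$1 - x$2$2) * z$1$2 - 2 * x$1$2 * z$1$1"
      using False by (simp add: k_def field_simps)
    have "z$1$2 * (x$1$2 * z$2$1 - x$2$1 * z$1$2) = z$1$2 * (k * z$1$1)"
         "z$1$2 * (x$2$1 * (2 * z$1$1) - (x$1$1 - x$2$2) * z$2$1) = z$1$2 * (k * z$2$1)"
      using k det' perp by algebra+
    then have "x$1$2 * z$2$1 - x$2$1 * z$1$2 = k * z$1$1"
         "x$2$1 * (2 * z$1$1) - (x$1$1 - x$2$2) * z$2$1 = k * z$2$1"
      using False by simp_all
    then have "commutator x z = mat_scale k z"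
      using k by (simp add: vec_eq_iff forall_2 commutator_entries tr algebra_simps)
    then show ?thesis ..
  next
    case True
    \<comment> \<open>Only \<open>z$2$1\<close> can survive, and \<open>perp\<close> then clears the
      diagonal of \<open>[x, z]\<close>.\<close>
    then have z: "z$1$1 = 0" "z$2$2 = 0" using det' tr by simp_all
    have "x$1$2 * z$2$1 = 0" using perp True z by simp
    then have "commutator x z = mat_scale (- (x$1$1 - x$2$2)) z"
      by (simp add: vec_eq_iff forall_2 commutator_entries True z algebra_simps)
    then show ?thesis ..
  qed
qed

lemma solvable_pair_iff:
  fixes x y :: "'a::field^2^2"
  assumes "(2::'a) \<noteq> 0"
  shows "gl2.solvable (gl2.generated {x, y}) \<longleftrightarrow> det (commutator x y) = 0"
proof
  define z where "z = commutator x y"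
  have tr: "z$2$2 = - z$1$1" by (simp add: z_def commutator_entries)
  assume sol: "gl2.solvable (gl2.generated {x, y})"
  show "det (commutator x y) = 0"
  proof (rule ccontr)
    assume nz: "det (commutator x y) \<noteq> 0"
    then have z: "commutator x y \<noteq> 0" by (auto simp: det_2)
    have "4 = (2::'a) * 2" by simp
    then have k: "4 * det (commutator x y) \<noteq> 0" "- 4 * det (commutator x y) \<noteq> 0"
      using nz assms by (metis mult_eq_0_iff neg_equal_0_iff_equal)+
    \<comment> \<open>By Cayley-Hamilton the square of \<open>z\<close> is the scalar
      \<open>- det z\<close>, so the square of \<open>ad z\<close> acts on the image of
      \<open>ad z\<close> as \<open>- 4 * det z\<close>.\<close>
    have dbl: "commutator z (commutator z (commutator w z))
        = mat_scale (- 4 * det z) (commutator w z)" for w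
      by (simp add: vec_eq_iff forall_2 commutator_entries det_2 tr algebra_simps)
    \<comment> \<open>The cross product analogue is (x \<times> z) \<times> (y \<times> z) = |z|^2 z
      for z = x \<times> y; the identity depends on \<open>z\<close> being the commutator of
      \<open>x\<close> and \<open>y\<close>.\<close>
    have uv: "commutator (commutator x z) (commutator y z) = mat_scale (4 * det z) z"
      unfolding z_def
      by (simp only: vec_eq_iff forall_2 commutator_entries det_2 mat_scale_nth) (intro conjI; algebra)
    show False
      using gl2.not_solvable_generated_pair_if[OF uv[unfolded z_def] dbl[unfolded z_def]
          dbl[unfolded z_def] k z] sol by blast
  qed
next
  define z where "z = commutator x y"
  assume det: "det (commutator x y) = 0"
  \<comment> \<open>The trace condition holds for both \<open>x\<close> and \<open>y\<close>, since
    \<open>x [x, y]\<close> and \<open>y [x, y]\<close> have trace 0 by cyclicity.\<close>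
  have "\<exists>c. commutator x z = mat_scale c z" "\<exists>c. commutator y z = mat_scale c z"
    by (rule commutator_singular_traceless;
        use det in \<open>simp add: z_def commutator_entries algebra_simps\<close>)+
  then show "gl2.solvable (gl2.generated {x, y})"
    unfolding z_def using gl2.solvable_generated_pair_if by blast
qed

section \<open>Counting over a finite field\<close>

text \<open>In odd characteristic this is one plus the quadratic character, and
  \<open>nroots (disc x)\<close> is the number of distinct eigenvalues of \<open>x\<close> in the
  field.\<close>

definition nroots :: "'a::{field,finite} \<Rightarrow> nat" where
  "nroots s = card {t. t^2 = s}"

text \<open>Trace squared minus four times the determinant, in a form that depends on
  \<open>x\<close> only modulo scalar matrices.\<close>

definition disc :: "'a::field^2^2 \<Rightarrow> 'a" where
  "disc x = (x$1$1 - x$2$2)^2 + 4 * x$1$2 * x$2$1"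

definition mat2 :: "'a::field \<Rightarrow> 'a \<Rightarrow> 'a \<Rightarrow> 'a \<Rightarrow> 'a^2^2" where
  "mat2 a b c d = vector [vector [a, b], vector [c, d]]"

lemma mat2_nth [simp]:
  "mat2 a b c d $ 1 $ 1 = a" "mat2 a b c d $ 1 $ 2 = b"
  "mat2 a b c d $ 2 $ 1 = c" "mat2 a b c d $ 2 $ 2 = d"
  by (simp_all add: mat2_def)

lemma mat2_eqI:
  "x$1$1 = y$1$1 \<Longrightarrow> x$1$2 = y$1$2 \<Longrightarrow> x$2$1 = y$2$1 \<Longrightarrow> x$2$2 = y$2$2 \<Longrightarrow> x = (y :: 'a^2^2)"
  by (simp add: vec_eq_iff forall_2)

lemma nroots_0 [simp]: "nroots (0::'a::{field,finite}) = 1"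
  by (simp add: nroots_def)

lemma nroots_square:
  fixes t :: "'a::{field,finite}"
  assumes "(2::'a) \<noteq> 0" and "t \<noteq> 0"
  shows "nroots (t^2) = 2"
proof -
  have "t \<noteq> - t" using assms by (metis add.right_inverse mult_2 mult_eq_0_iff)
  moreover have "{u. u^2 = t^2} = {t, - t}" by (auto simp: power2_eq_iff)
  ultimately show ?thesis by (simp add: nroots_def)
qed

lemma nroots_cases:
  fixes s :: "'a::{field,finite}"
  assumes "(2::'a) \<noteq> 0"
  shows "nroots s = 0 \<and> s \<noteq> 0 \<or> nroots s = 1 \<and> s = 0 \<or> nroots s = 2 \<and> s \<noteq> 0"
proof (cases "\<exists>t. t^2 = s")
  case True
  then obtain t where t: "s = t^2" by blast
  then show ?thesis using nroots_square[OF assms, of t] by (cases "t = 0") auto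
next
  case False
  then have "nroots s = 0" by (simp add: nroots_def)
  moreover have "s \<noteq> 0" using False by (metis zero_power2)
  ultimately show ?thesis by simp
qed

text \<open>The fibres of squaring partition the field.\<close>

lemma sum_nroots: "(\<Sum>s\<in>UNIV. nroots (s::'a::{field,finite})) = CARD('a)"
proof -
  have "(\<Sum>s\<in>UNIV. nroots (s::'a)) = card (\<Union>s\<in>UNIV. {t::'a. t^2 = s})"
    unfolding nroots_def by (rule card_UN_disjoint[symmetric]) auto
  also have "(\<Union>s\<in>UNIV. {t::'a. t^2 = s}) = UNIV" by auto
  finally show ?thesis .
qed

text \<open>Counting elements by their number of roots, and counting roots by their squares, gives
  two linear equations for the two cardinalities.\<close>

lemma card_nroots:
  assumes "(2::'a::{field,finite}) \<noteq> 0"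
  shows "2 * card {s::'a. nroots s = 2} + 1 = CARD('a)"
    and "2 * card {s::'a. nroots s = 0} + 1 = CARD('a)"
proof -
  let ?R = "\<lambda>k. {s::'a. nroots s = k}"
  have U: "UNIV = (?R 0 \<union> ?R 2) \<union> {0}"
    using nroots_cases[OF assms] by auto
  have d: "?R 0 \<inter> ?R 2 = {}" "(?R 0 \<union> ?R 2) \<inter> {0} = {}"
    by auto
  have "CARD('a) = card ((?R 0 \<union> ?R 2) \<union> {0})" by (metis U)
  also have "\<dots> = card (?R 0) + card (?R 2) + 1"
    using d by (subst card_Un_disjoint; simp add: card_Un_disjoint)
  finally have c: "CARD('a) = card (?R 0) + card (?R 2) + 1" .
  have "CARD('a) = (\<Sum>s\<in>UNIV. nroots (s::'a))" by (rule sum_nroots[symmetric])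
  also have "\<dots> = (\<Sum>s\<in>(?R 0 \<union> ?R 2) \<union> {0}. nroots s)" by (metis U)
  also have "\<dots> = 2 * card (?R 2) + 1"
    using d by (subst sum.union_disjoint; simp add: sum.union_disjoint)
  finally have s: "CARD('a) = 2 * card (?R 2) + 1" .
  show "2 * card (?R 2) + 1 = CARD('a)" "2 * card (?R 0) + 1 = CARD('a)"
    using c s by simp_all
qed

text \<open>Over \<open>u = 0\<close> only \<open>m = 0\<close> is left; any other solution is
  \<open>m = t * u\<close> for a unique square root \<open>t\<close> of \<open>s\<close>.\<close>

lemma card_square_proportional:
  fixes s :: "'a::{field,finite}"
  shows "card {(u, m). m^2 = s * u^2} = 1 + (CARD('a) - 1) * nroots s"
proof -
  let ?A = "(UNIV - {0::'a}) \<times> {t. t^2 = s}"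
  have eq: "{(u, m). m^2 = s * u^2} = insert (0, 0) ((\<lambda>(u, t). (u, t * u)) ` ?A)"
  proof (intro equalityI subsetI)
    fix w assume "w \<in> {(u, m). m^2 = s * u^2}"
    then obtain u m where w: "w = (u, m)" "m^2 = s * u^2" by blast
    show "w \<in> insert (0, 0) ((\<lambda>(u, t). (u, t * u)) ` ?A)"
    proof (cases "u = 0")
      case False
      then have "(u, m / u) \<in> ?A" "w = (\<lambda>(u, t). (u, t * u)) (u, m / u)"
        using w by (simp_all add: power_divide)
      then show ?thesis by blast
    qed (use w in simp)
  qed (auto simp: power_mult_distrib)
  have "inj_on (\<lambda>(u, t). (u, t * u)) ((UNIV - {0::'a}) \<times> UNIV)" by (auto simp: inj_on_def)
  then have inj: "inj_on (\<lambda>(u, t). (u, t * u)) ?A" by (rule inj_on_subset) auto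
  have "(0, 0) \<notin> (\<lambda>(u, t). (u, t * u)) ` ?A" by auto
  then show ?thesis
    unfolding eq
    by (simp add: card_image[OF inj] card_cartesian_product nroots_def card_Diff_singleton)
qed

section \<open>Matrices of given discriminant\<close>

lemma card_mult_eq:
  fixes t :: "'a::{field,finite}"
  shows "card {(b, c). b * c = t} = CARD('a) - 1 + (if t = 0 then CARD('a) else 0)"
proof -
  let ?f = "\<lambda>b. (b, t / b)"
  have inj: "inj_on ?f (UNIV - {0})" by (auto simp: inj_on_def)
  have eq: "{(b, c). b * c = t} =
      ?f ` (UNIV - {0}) \<union> {0} \<times> (if t = 0 then UNIV else {})"
    by (auto simp: image_iff field_simps)
  show ?thesis
    unfolding eq
    by (subst card_Un_disjoint)
       (auto simp: card_image[OF inj] card_cartesian_product card_Diff_singleton)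
qed

text \<open>With \<open>x$2$2\<close> and \<open>p = x$1$1 - x$2$2\<close> chosen, the off-diagonal
  product is fixed. It is 0 for exactly \<open>nroots s\<close> values of \<open>p\<close>, each of
  which gives \<open>CARD('a)\<close> additional pairs.\<close>

lemma card_disc_eq:
  fixes s :: "'a::{field,finite}"
  assumes "(2::'a) \<noteq> 0"
  shows "card {x::'a^2^2. disc x = s} = CARD('a)^2 * (CARD('a) - 1 + nroots s)"
proof -
  have "(4::'a) = 2 * 2" by simp
  then have 4: "(4::'a) \<noteq> 0" using assms by (metis mult_eq_0_iff)
  let ?T = "\<lambda>p::'a. {(b::'a, c::'a). b * c = (s - p^2) / 4}"
  let ?S = "SIGMA p:UNIV. ?T p"
  have "bij_betw (\<lambda>x. (x$2$2, x$1$1 - x$2$2, x$1$2, x$2$1)) {x::'a^2^2. disc x = s} (UNIV \<times> ?S)"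
    by (rule bij_betw_byWitness[where f' = "\<lambda>(d, p, b, c). mat2 (p + d) b c d"])
       (use 4 in \<open>auto simp: disc_def field_simps intro!: mat2_eqI\<close>)
  then have "card {x::'a^2^2. disc x = s} = CARD('a) * card ?S"
    by (simp add: bij_betw_same_card card_cartesian_product)
  also have "card ?S = (\<Sum>p\<in>UNIV. card (?T p))" by simp
  also have "\<dots> = (\<Sum>p\<in>UNIV. CARD('a) - 1 + (if p^2 = s then CARD('a) else 0))"
    unfolding card_mult_eq using 4 by (intro sum.cong refl) auto
  also have "\<dots> = CARD('a) * (CARD('a) - 1) + CARD('a) * nroots s"
    unfolding sum.distrib by (simp add: sum.If_cases nroots_def mult.commute)
  finally show ?thesis by (simp add: power2_eq_square algebra_simps)
qed

lemma card_disc_nroots: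
  assumes "(2::'a::{field,finite}) \<noteq> 0"
  shows "card {x::'a^2^2. nroots (disc x) = k}
    = card {s::'a. nroots s = k} * (CARD('a)^2 * (CARD('a) - 1 + k))"
proof -
  have U: "{x::'a^2^2. nroots (disc x) = k} = (\<Union>s\<in>{s. nroots s = k}. {x. disc x = s})" by auto
  have "card {x::'a^2^2. nroots (disc x) = k}
      = (\<Sum>s\<in>{s. nroots s = k}. card {x::'a^2^2. disc x = s})"
    unfolding U by (rule card_UN_disjoint) auto
  also have "\<dots> = (\<Sum>s\<in>{s::'a. nroots s = k}. CARD('a)^2 * (CARD('a) - 1 + k))"
    by (intro sum.cong refl) (simp add: card_disc_eq[OF assms])
  finally show ?thesis by simp
qed

section \<open>Matrices with singular commutator against a fixed one\<close>

text \<open>For z = [x, y] the trace of x z is 0, that is, a z11 + b z21 + c z12 = 0. If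
  \<open>b\<close> or \<open>c\<close> is nonzero, this eliminates an off-diagonal entry of z and
  makes det z a binary quadratic form with discriminant \<open>disc x\<close> up to a nonzero
  factor; completing the square yields the equation in \<open>u\<close> and
  \<open>m\<close>.\<close>

lemma card_det_commutator_zero:
  fixes x :: "'a::{field,finite}^2^2"
  assumes two: "(2::'a) \<noteq> 0"
    and x: "\<not> (x$1$1 = x$2$2 \<and> x$1$2 = 0 \<and> x$2$1 = 0)"
  shows "card {y. det (commutator x y) = 0}
    = CARD('a)^2 * (1 + (CARD('a) - 1) * nroots (disc x))"
proof -
  define a b c where "a = x$1$1 - x$2$2" and "b = x$1$2" and "c = x$2$1"
  note abc = a_def[symmetric] b_def[symmetric] c_def[symmetric]
  have "(4::'a) = 2 * 2" by simp
  then have 4: "(4::'a) \<noteq> 0" using two by (metis mult_eq_0_iff)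
  have disc: "disc x = a^2 + 4 * b * c" by (simp add: disc_def a_def b_def c_def)
  define d where "d y = (b * y$2$1 - c * y$1$2)^2
      + (a * y$1$2 - b * (y$1$1 - y$2$2)) * (c * (y$1$1 - y$2$2) - a * y$2$1)" for y :: "'a^2^2"
  have det: "det (commutator x y) = - d y" for y
    unfolding d_def det_2 commutator_entries abc by algebra
  let ?A = "{y. det (commutator x y) = 0}"
  let ?B = "UNIV \<times> UNIV \<times> {(u, m). m^2 = disc x * u^2} :: ('a \<times> 'a \<times> 'a \<times> 'a) set"
  \<comment> \<open>As \<open>f\<close> and \<open>g\<close> are inverse to each other on the whole
    types, it suffices to match membership along \<open>f\<close>.\<close>
  have witness: "\<exists>f. bij_betw f ?A ?B"
    if gf: "\<And>y. g (f y) = y" and fg: "\<And>w. f (g w) = w" and AB: "\<And>y. f y \<in> ?B \<longleftrightarrow> y \<in> ?A"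
    for f g
  proof (intro exI bij_betw_byWitness)
    show "\<forall>y\<in>?A. g (f y) = y" "\<forall>w\<in>?B. f (g w) = w" using gf fg by blast+
    show "f ` ?A \<subseteq> ?B" using AB by blast
    show "g ` ?B \<subseteq> ?A"
    proof (rule image_subsetI)
      fix w assume "w \<in> ?B"
      then have "f (g w) \<in> ?B" by (simp only: fg)
      then show "g w \<in> ?A" by (simp only: AB)
    qed
  qed
  consider (b) "b \<noteq> 0" | (c) "c \<noteq> 0" | (a) "a \<noteq> 0" "b = 0" "c = 0"
    using x unfolding a_def b_def c_def by force
  then have "\<exists>f. bij_betw f ?A ?B"
  proof cases
    case b
    \<comment> \<open>Here u = z12 and m = 2 b z11 - a z12, which completes the square in b
      \<open>d y\<close> = b z11^2 - a z11 z12 - c z12^2.\<close>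
    define f where "f = (\<lambda>y::'a^2^2. (y$2$2, y$1$2, a * y$1$2 - b * (y$1$1 - y$2$2),
      2 * b * (b * y$2$1 - c * y$1$2) - a * (a * y$1$2 - b * (y$1$1 - y$2$2))))"
    define g where "g = (\<lambda>(e, r, u, m).
      mat2 (e + (a * r - u) / b) r (((m + a * u) / (2 * b) + c * r) / b) e)"
    have gf: "g (f y) = y" for y
      using b two by (auto simp: f_def g_def field_simps intro!: mat2_eqI)
    have fg: "f (g w) = w" for w
      using b two by (cases w) (simp add: f_def g_def field_simps)
    have key: "(2 * b * (b * y$2$1 - c * y$1$2) - a * (a * y$1$2 - b * (y$1$1 - y$2$2)))^2
        - disc x * (a * y$1$2 - b * (y$1$1 - y$2$2))^2 = (2 * b)^2 * d y" for y
      unfolding disc d_def by algebra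
    have "f y \<in> ?B \<longleftrightarrow> (2 * b)^2 * d y = 0" for y
      unfolding key[symmetric] by (simp add: f_def)
    then have "f y \<in> ?B \<longleftrightarrow> y \<in> ?A" for y
      using b two 4 by (simp add: det)
    with gf fg show ?thesis by (rule witness)
  next
    case c
    \<comment> \<open>The previous case after transposing \<open>x\<close> and \<open>y\<close>,
      which exchanges \<open>b\<close> and \<open>c\<close>.\<close>
    define f where "f = (\<lambda>y::'a^2^2. (y$2$2, y$2$1, a * y$2$1 - c * (y$1$1 - y$2$2),
      2 * c * (c * y$1$2 - b * y$2$1) - a * (a * y$2$1 - c * (y$1$1 - y$2$2))))"
    define g where "g = (\<lambda>(e, r, u, m).
      mat2 (e + (a * r - u) / c) (((m + a * u) / (2 * c) + b * r) / c) r e)"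
    have gf: "g (f y) = y" for y
      using c two by (auto simp: f_def g_def field_simps intro!: mat2_eqI)
    have fg: "f (g w) = w" for w
      using c two by (cases w) (simp add: f_def g_def field_simps)
    have key: "(2 * c * (c * y$1$2 - b * y$2$1) - a * (a * y$2$1 - c * (y$1$1 - y$2$2)))^2
        - disc x * (a * y$2$1 - c * (y$1$1 - y$2$2))^2 = (2 * c)^2 * d y" for y
      unfolding disc d_def by algebra
    have "f y \<in> ?B \<longleftrightarrow> (2 * c)^2 * d y = 0" for y
      unfolding key[symmetric] by (simp add: f_def)
    then have "f y \<in> ?B \<longleftrightarrow> y \<in> ?A" for y
      using c two 4 by (simp add: det)
    with gf fg show ?thesis by (rule witness)
  next
    case a
    \<comment> \<open>Now \<open>d y\<close> is -a^2 y12 y21, and 4 y12 y21 is the square of the sum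
      minus the square of the difference.\<close>
    define f where "f = (\<lambda>y::'a^2^2. (y$2$2, y$1$1, y$1$2 - y$2$1, a * (y$1$2 + y$2$1)))"
    define g where "g = (\<lambda>(e, r, u, m). mat2 r ((m / a + u) / 2) ((m / a - u) / 2) e)"
    have gf: "g (f y) = y" for y
      using a two by (auto simp: f_def g_def field_simps intro!: mat2_eqI)
    have fg: "f (g w) = w" for w
      using a two 4 by (cases w) (simp add: f_def g_def field_simps)
    have key: "(a * (y$1$2 + y$2$1))^2 - disc x * (y$1$2 - y$2$1)^2 = - 4 * d y" for y
      unfolding disc d_def a(2,3) by (simp add: power2_eq_square algebra_simps)
    have "f y \<in> ?B \<longleftrightarrow> - 4 * d y = 0" for y
      unfolding key[symmetric] by (simp add: f_def)
    then have "f y \<in> ?B \<longleftrightarrow> y \<in> ?A" for y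
      using 4 by (simp add: det)
    with gf fg show ?thesis by (rule witness)
  qed
  then have "card ?A = card ?B" using bij_betw_same_card by blast
  then show ?thesis
    unfolding card_cartesian_product card_square_proportional power2_eq_square[of "CARD('a)"]
    by (simp only: mult.assoc)
qed

section \<open>The solvable graph\<close>

definition scalars :: "('a::field^2^2) set" where
  "scalars = {x. x$1$1 = x$2$2 \<and> x$1$2 = 0 \<and> x$2$1 = 0}"

lemma card_scalars: "card (scalars :: ('a::{field,finite}^2^2) set) = CARD('a)"
proof -
  have "bij_betw (\<lambda>x. x$1$1) (scalars :: ('a^2^2) set) UNIV"
    by (rule bij_betw_byWitness[where f' = "\<lambda>a. mat2 a 0 0 a"])
       (auto simp: scalars_def intro!: mat2_eqI)
  then show ?thesis by (rule bij_betw_same_card)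
qed

lemma commutator_scalar: "y \<in> scalars \<Longrightarrow> commutator x y = 0" "x \<in> scalars \<Longrightarrow> commutator x y = 0"
  by (auto simp: scalars_def vec_eq_iff forall_2 commutator_nth algebra_simps)

lemma det_commutator_scalar:
  fixes x y :: "'a::field^2^2"
  shows "y \<in> scalars \<Longrightarrow> det (commutator x y) = 0" "x \<in> scalars \<Longrightarrow> det (commutator x y) = 0"
  by (simp_all add: commutator_scalar det_2)

lemma det_commutator_commute: "det (commutator y x) = det (commutator x y)"
  for x y :: "'a::field^2^2"
  by (simp add: det_2 commutator_entries algebra_simps)

text \<open>Scalars commute with everything. For non-scalar \<open>x\<close>, at most q^2 (2q - 1) <
  q^4 matrices have a singular commutator with \<open>x\<close>, where q = \<open>CARD('a)\<close>,
  so some matrix generates a non-solvable subalgebra with it.\<close>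

lemma solvabilizer_gl2:
  assumes two: "(2::'a::{field,finite}) \<noteq> 0"
  shows "gl2.solvabilizer = (scalars :: ('a^2^2) set)"
proof -
  \<comment> \<open>The nonzero square 1 has two roots, so the cardinality in
    \<open>card_nroots\<close> is at least 1.\<close>
  have q: "CARD('a) \<ge> 3"
    using card_nroots(1)[OF two] nroots_square[OF two, of 1]
    by (cases "card {s::'a. nroots s = 2}") auto
  have "x \<in> scalars" if x: "x \<in> gl2.solvabilizer" for x :: "'a^2^2"
  proof (rule ccontr)
    assume ns: "x \<notin> scalars"
    have "\<forall>y. det (commutator x y) = 0"
      using x unfolding gl2.solvabilizer_def
      by (simp add: solvable_pair_iff[OF two] det_commutator_commute[of x])
    then have "{y. det (commutator x y) = 0} = UNIV" by blast
    then have "CARD('a^2^2) = CARD('a)^2 * (1 + (CARD('a) - 1) * nroots (disc x))"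
      using card_det_commutator_zero[OF two, of x] ns unfolding scalars_def by simp
    moreover have "CARD('a^2^2) = CARD('a)^2 * CARD('a)^2"
      by (simp add: power2_eq_square)
    ultimately have "CARD('a)^2 * CARD('a)^2
        = CARD('a)^2 * (1 + (CARD('a) - 1) * nroots (disc x))" by (rule trans[OF sym, rotated])
    then have "CARD('a)^2 = 1 + (CARD('a) - 1) * nroots (disc x)"
      unfolding mult_cancel1 using q by force
    also have "\<dots> \<le> 1 + (CARD('a) - 1) * 2"
      using nroots_cases[OF two, of "disc x"] by (intro add_mono mult_mono) auto
    also have "\<dots> < CARD('a) * CARD('a)"
      using mult_le_mono1[OF q, of "CARD('a)"] q by linarith
    finally show False by (simp add: power2_eq_square)
  qed
  moreover have "x \<in> gl2.solvabilizer" if "x \<in> scalars" for x :: "'a^2^2"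
    using that unfolding gl2.solvabilizer_def
    by (simp add: solvable_pair_iff[OF two] det_commutator_scalar)
  ultimately show ?thesis by blast
qed

section \<open>Degrees and their multiplicities\<close>

text \<open>An edge at \<open>x\<close> is determined by its other end. The matrices with singular
  commutator against \<open>x\<close> include all scalars and \<open>x\<close> itself, none of which
  is a neighbour; this accounts for the two subtractions.\<close>

lemma degree_solvable_graph_gl2:
  fixes x :: "'a::{field,finite}^2^2"
  assumes two: "(2::'a) \<noteq> 0" and x: "x \<notin> scalars"
  shows "degree gl2.solvable_graph x
    = CARD('a)^2 * (1 + (CARD('a) - 1) * nroots (disc x)) - CARD('a) - 1"
proof -
  let ?N = "{y. det (commutator x y) = 0}"
  let ?Y = "?N - scalars - {x}"
  have S: "snd (gl2.solvable_graph :: ('a^2^2) graph)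
      = {{a, b} | a b. a \<notin> scalars \<and> b \<notin> scalars \<and> a \<noteq> b \<and> det (commutator a b) = 0}"
    by (simp add: gl2.solvable_graph_def solvabilizer_gl2[OF two] solvable_pair_iff[OF two])
  have E: "{e \<in> snd gl2.solvable_graph. x \<in> e} = (\<lambda>y. {x, y}) ` ?Y"
  proof (intro equalityI subsetI)
    fix e assume "e \<in> {e \<in> snd gl2.solvable_graph. x \<in> e}"
    then obtain a b where e: "e = {a, b}" "a \<notin> scalars" "b \<notin> scalars" "a \<noteq> b"
        "det (commutator a b) = 0" "x = a \<or> x = b"
      unfolding S by blast
    from e(6) show "e \<in> (\<lambda>y. {x, y}) ` ?Y"
    proof
      assume "x = a"
      with e(2-5) have "b \<in> ?Y" by blast
      then show ?thesis using \<open>x = a\<close> e(1) by blast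
    next
      assume "x = b"
      with e(2-5) have "a \<in> ?Y" by (simp add: det_commutator_commute)
      then show ?thesis using \<open>x = b\<close> e(1) by blast
    qed
  next
    fix e assume "e \<in> (\<lambda>y. {x, y}) ` ?Y"
    then show "e \<in> {e \<in> snd gl2.solvable_graph. x \<in> e}"
      unfolding S using x by blast
  qed
  have "inj_on (\<lambda>y. {x, y}) ?Y" by (auto simp: inj_on_def doubleton_eq_iff)
  then have "degree gl2.solvable_graph x = card ?Y"
    unfolding degree_def E by (rule card_image)
  also have "\<dots> = card ?N - card (scalars :: ('a^2^2) set) - 1"
  proof -
    have "scalars \<subseteq> ?N" by (auto simp: det_commutator_scalar)
    moreover have "x \<in> ?N" by (simp add: gl2.bracket_self det_2)
    ultimately show ?thesis using x by (simp add: card_Diff_subset card_Diff_singleton)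
  qed
  finally show ?thesis
    using x unfolding card_scalars
    by (subst (asm) card_det_commutator_zero[OF two]) (simp_all add: scalars_def)
qed

lemma image_mset_const_on:
  assumes "\<And>x. x \<in> A \<Longrightarrow> f x = c"
  shows "image_mset f (mset_set A) = replicate_mset (card A) c"
proof (cases "finite A")
  case True
  then show ?thesis using assms by (induction A) auto
qed simp

theorem theorem4p4:
  fixes q :: nat
  assumes "CARD('a::{field,finite}) = q"
    and "q > 2"
    and "\<not> gl2.solvable (UNIV :: ('a^2^2) set)"
  shows "degree_sequence (gl2.solvable_graph :: ('a^2^2) graph) =
      replicate_mset (q^2 * (q^2 - 1) div 2) (2 * q^3 - q^2 - q - 1)
    + replicate_mset (q^3 - q) (q^3 - q - 1)
    + replicate_mset (q^2 * (q - 1)^2 div 2) (q^2 - q - 1)"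
proof -
  have two: "(2::'a) \<noteq> 0" using assms(3) by (simp add: gl2_solvable_iff)
  define R where "R k = {x::'a^2^2. nroots (disc x) = k}" for k
  define D where "D k = q^2 * (1 + (q - 1) * k) - q - 1" for k
  have disc_scalar: "nroots (disc x) = 1" if "x \<in> scalars" for x :: "'a^2^2"
    using that by (simp add: scalars_def disc_def)
  \<comment> \<open>Scalars have discriminant 0, so they must be removed from \<open>R 1\<close>
    only.\<close>
  have V: "UNIV - scalars = R 2 \<union> (R 1 - scalars) \<union> R 0"
  proof (rule set_eqI)
    show "x \<in> UNIV - scalars \<longleftrightarrow> x \<in> R 2 \<union> (R 1 - scalars) \<union> R 0" for x :: "'a^2^2"
      using nroots_cases[OF two, of "disc x"] disc_scalar[of x] by (auto simp: R_def)
  qed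
  have disj: "R 2 \<inter> (R 1 - scalars) = {}" "(R 2 \<union> (R 1 - scalars)) \<inter> R 0 = {}"
    by (auto simp: R_def)
  have deg: "image_mset (degree gl2.solvable_graph) (mset_set A) = replicate_mset (card A) (D k)"
    if "A \<subseteq> R k - scalars" for A k
    using that by (intro image_mset_const_on)
      (auto simp: degree_solvable_graph_gl2[OF two] assms(1) R_def D_def)
  have ns: "R 2 \<subseteq> R 2 - scalars" "R 0 \<subseteq> R 0 - scalars"
    using disc_scalar by (auto simp: R_def)
  have fst: "fst (gl2.solvable_graph :: ('a^2^2) graph) = UNIV - scalars"
    by (simp add: gl2.solvable_graph_def solvabilizer_gl2[OF two])
  have ds: "degree_sequence (gl2.solvable_graph :: ('a^2^2) graph)
      = replicate_mset (card (R 2)) (D 2) + replicate_mset (card (R 1 - scalars)) (D 1)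
        + replicate_mset (card (R 0)) (D 0)"
    unfolding degree_sequence_def fst V
    using disj by (simp add: mset_set_Union deg[OF ns(1)] deg[OF ns(2)] deg[OF subset_refl])
  \<comment> \<open>With \<open>q = 2 * n + 1\<close> both halvings are exact: the classes
    \<open>R 2\<close> and \<open>R 0\<close> have n q^2 (q + 1) and n q^2 (q - 1) elements.\<close>
  define n where "n = card {s::'a. nroots s = 2}"
  have n: "q = 2 * n + 1" "card {s::'a. nroots s = 2} = n" "card {s::'a. nroots s = 0} = n"
    using card_nroots[OF two] assms(1) unfolding n_def by linarith+
  have "nroots s = 1 \<longleftrightarrow> s = 0" for s :: 'a
    using nroots_cases[OF two, of s] by auto
  then have R1: "card (R 1) = q^3"
    using card_disc_nroots[OF two, of 1] assms by (simp add: R_def power3_eq_cube power2_eq_square)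
  have "scalars \<subseteq> R 1" using disc_scalar by (auto simp: R_def)
  with R1 have "card (R 1 - scalars) = q^3 - q"
    by (simp add: card_Diff_subset card_scalars assms(1))
  moreover have "card (R 2) = q^2 * (q^2 - 1) div 2"
    using card_disc_nroots[OF two, of 2] n
    by (simp add: R_def assms(1) power2_eq_square algebra_simps)
  moreover have "card (R 0) = q^2 * (q - 1)^2 div 2"
    using card_disc_nroots[OF two, of 0] n
    by (simp add: R_def assms(1) power2_eq_square algebra_simps)
  moreover have "D 2 = 2 * q^3 - q^2 - q - 1" "D 1 = q^3 - q - 1" "D 0 = q^2 - q - 1"
    unfolding D_def n(1) by (simp_all add: power2_eq_square power3_eq_cube algebra_simps)
  ultimately show ?thesis unfolding ds by simp
qed

end
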